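(* Let $N=n+s+r$ with $N,n\ge1$, let $A_1,\dots,A_m\subseteq\{0,1\}^{n+s}$ and $B_1,\dots,B_\ell\subseteq\{0,1\}^{n+r}$, let $\tilde A_j,\tilde B_j\subseteq\{0,1\}^N$ be their cylinders and let $U,V\subseteq\{0,1\}^n$ be the associated sets (see context). Assume the monotonicity condition: for all $u,u'\in\{0,1\}^n$, $b\in\{0,1\}^s$, if $(u,b)\in\bigcap_{j\le m}A_j$ and $u'\ge u$ then $(u',b)\in\bigcap_{j\le m}A_j$. Let $e\ge1$, $\epsilon>0$ and let $(C_{\mathbf r})_{\mathbf r}$, $C_{\mathbf r}=(C^1_{\mathbf r},\dots,C^e_{\mathbf r})$, be a random distribution on $e$-tuples of subsets of $\{0,1\}^N$ such that $\left(\bigcap_{i\le e}C^i_{\mathbf r}\right)_{\mathbf r}$ is an $\epsilon$-approximation of $\{0,1\}^N$. Assume that for all samples $\mathbf r$ there is a semantic refutation $\pi_{\mathbf r}$ of $$\tilde A_1,\dots,\tilde A_m,\tilde B_1,\dots,\tilde B_\ell,C^1_{\mathbf r},\dots,C^e_{\mathbf r}$$ with $k$ lines, such that the monotone communication complexity (w.r.t. $U$) of all sets in $\pi_{\mathbf r}$ is at most $t$. Then there is a randomized protocol for $KW^m[U,V]$ of size at most $k+n+e$ and also at most $2k+n$, of communication complexity $O(t)$ and of error at most $\epsilon$. Moreover, if the refutations $\pi_{\mathbf r}$ are tree-like then also the randomized protocol is tree-like.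
   Context: $O(\cdot)$ hides an absolute constant. Set-up. $\tilde A:=\{(a,b,c): (a,b)\in A,\ c\in\{0,1\}^r\}$ for $A\subseteq\{0,1\}^{n+s}$ and $\tilde B:=\{(a,b,c): (a,c)\in B,\ b\in\{0,1\}^s\}$ for $B\subseteq\{0,1\}^{n+r}$, where $a\in\{0,1\}^n$. $U=\{u\in\{0,1\}^n:\exists b\in\{0,1\}^s,\ (u,b)\in\bigcap_{j\le m}A_j\}$, $V=\{v\in\{0,1\}^n:\exists c\in\{0,1\}^r,\ (v,c)\in\bigcap_{j\le\ell}B_j\}$. The order $\le$ on $\{0,1\}^n$ is coordinatewise. $U$ and $V$ are assumed disjoint (so that $KW^m[U,V]$ is defined). Semantic refutation. A sequence $D_1,\dots,D_k\subseteq\{0,1\}^N$ is a semantic refutation (with $k$ lines) of given sets $E_1,\dots,E_p\subseteq\{0,1\}^N$ if each $D_i$ is either one of the $E_j$ or contains $D_{j_1}\cap D_{j_2}$ for some $j_1,j_2<i$, and $D_k=\emptyset$. It is tree-like if each $D_i$ is used at most once as a premise. Monotone communication complexity of a set. For $D\subseteq\{0,1\}^N$, $u,v\in\{0,1\}^n$, $q^u\in\{0,1\}^s$, $r^v\in\{0,1\}^r$ consider the tasks: (1) decide whether $(u,q^u,r^v)\in D$; (2) decide whether $(v,q^u,r^v)\in D$; (3) if exactly one of $(u,q^u,r^v),(v,q^u,r^v)$ is in $D$, find $i\le n$ with $u_i\ne v_i$; (4) if $(u,q^u,r^v)\in D$ and $(v,q^u,r^v)\notin D$, either find $i\le n$ with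 $u_i=1\wedge v_i=0$, or decide that there is $u'\ge u$ with $(u',q^u,r^v)\notin D$. $CC(D)$ is the minimal $t$ such that tasks (1)–(3) can be solved by two players, one knowing $u,q^u$ and the other $v,r^v$, exchanging at most $t$ bits. The monotone communication complexity w.r.t. $U$, $MCC_U(D)$, is the minimal $t\ge CC(D)$ such that also task (4) can be solved by exchanging at most $t$ bits. Approximation. A random distribution $(Y_{\mathbf r})_{\mathbf r}$ on subsets of $\{0,1\}^N$ is an $\epsilon$-approximation of $X\subseteq\{0,1\}^N$ if for all $w\in\{0,1\}^N$, $\mathrm{Prob}_{\mathbf r}[w\in X\triangle Y_{\mathbf r}]\le\epsilon$. $KW^m[U,V]$ (for disjoint $U,V$ with $U$ closed upwards) is the multi-function on $U\times V$ with values in $[n]$ whose valid values at $(u,v)$ are all $i$ with $u_i=1\wedge v_i=0$. Protocols. For a multi-function $R\subseteq U\times V\times I$ consider 4-tuples $\mathbf P=(G,\mathsf{lab},F,S)$: (P1) $G$ is a directed acyclic graph with one source, the root $\emptyset$; (P2) nodes of out-degree $0$ (leaves) are labelled by $\mathsf{lab}$ by elements of $I$; (P3) $S(u,v,x)$ assigns to a non-leaf node $x$ and $(u,v)\in U\times V$ a node reachable by an edge from $x$; (P4a) for every $(u,v)$, $F(u,v)$ is a set of nodes of $G$ with $\emptyset\in F(u,v)$. Size of $\mathbf P$: number of nodes of $G$. $CC(\mathbf P)$: the minimal $t$ such that for every node $x$ two players, one knowing $u,x$ and the other $v,x$, can decide $x\in F(u,v)$, and compute $S(u,v,x)$, each by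 exchanging at most $t$ bits. A randomized protocol for $R$ with error $\epsilon$ is a random variable $(\mathbf P_{\mathbf r})_{\mathbf r}$ of such 4-tuples such that for every $(u,v)\in U\times V$: (P4b') $\mathrm{Prob}_{\mathbf r}[\exists x,\ x\in F_{\mathbf r}(u,v)\wedge S_{\mathbf r}(u,v,x)\notin F_{\mathbf r}(u,v)]\le\epsilon$, and (P4c') $\mathrm{Prob}_{\mathbf r}[\exists\text{ leaf }x\in F_{\mathbf r}(u,v),\ \mathsf{lab}_{\mathbf r}(x)=i\wedge\neg R(u,v,i)]\le\epsilon$. Its size and communication complexity are the maxima over $\mathbf r$; it is tree-like if each $G_{\mathbf r}$ is a tree.
   Formalization: The tree-like clause is corrected, since a literal tree within the stated node bounds can fail to exist: the protocol of the stated size is a tree whose leaves may be shared, and there is also a genuine tree protocol meeting the size bounds when equally labelled leaves are counted once. *)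

theory Defs
  imports "HOL-Probability.Probability_Mass_Function" "HOL-Library.Extended_Nat"
begin

text \<open>Points of \<open>{0,1}\<^sup>n\<close> are Boolean lists of length \<open>n\<close>, a tuple \<open>(a,b,c)\<close> of such points is the
  concatenation \<open>a @ b @ c\<close>, and coordinates are numbered from \<open>0\<close>, so that \<open>[n]\<close> is \<open>{..<n}\<close>.\<close>

definition cube :: "nat \<Rightarrow> bool list set" where
  "cube n = {x. length x = n}"

definition coord_le :: "bool list \<Rightarrow> bool list \<Rightarrow> bool" where
  "coord_le u u' \<longleftrightarrow> list_all2 (\<le>) u u'"

definition cyl_A :: "nat \<Rightarrow> nat \<Rightarrow> nat \<Rightarrow> bool list set \<Rightarrow> bool list set" where
  "cyl_A n s r A = {a @ b @ c | a b c. a \<in> cube n \<and> b \<in> cube s \<and> c \<in> cube r \<and> a @ b \<in> A}"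

definition cyl_B :: "nat \<Rightarrow> nat \<Rightarrow> nat \<Rightarrow> bool list set \<Rightarrow> bool list set" where
  "cyl_B n s r B = {a @ b @ c | a b c. a \<in> cube n \<and> b \<in> cube s \<and> c \<in> cube r \<and> a @ c \<in> B}"

text \<open>The projection \<open>{u \<in> {0,1}\<^sup>n. \<exists>b \<in> {0,1}\<^sup>d. (u,b) \<in> \<Inter>As}\<close>; it gives \<open>U\<close> for \<open>d = s\<close> and the sets
  \<open>A\<^sub>j\<close>, and \<open>V\<close> for \<open>d = r\<close> and the sets \<open>B\<^sub>j\<close>.\<close>

definition proj_set :: "nat \<Rightarrow> nat \<Rightarrow> bool list set list \<Rightarrow> bool list set" where
  "proj_set n d As = {u \<in> cube n. \<exists>b \<in> cube d. \<forall>A \<in> set As. u @ b \<in> A}"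

section \<open>Two-party communication\<close>

text \<open>At an inner node one of the players sends a bit depending on their own input; the output is
  determined by the transcript.\<close>

datatype ('a, 'b, 'o) comm_tree =
    Output 'o
  | Bit1 "'a \<Rightarrow> bool" "('a, 'b, 'o) comm_tree" "('a, 'b, 'o) comm_tree"
  | Bit2 "'b \<Rightarrow> bool" "('a, 'b, 'o) comm_tree" "('a, 'b, 'o) comm_tree"

primrec comm_run :: "('a, 'b, 'o) comm_tree \<Rightarrow> 'a \<Rightarrow> 'b \<Rightarrow> 'o" where
  "comm_run (Output z) x y = z"
| "comm_run (Bit1 f T T') x y = (if f x then comm_run T x y else comm_run T' x y)"
| "comm_run (Bit2 g T T') x y = (if g y then comm_run T x y else comm_run T' x y)"

primrec comm_bits :: "('a, 'b, 'o) comm_tree \<Rightarrow> nat" where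
  "comm_bits (Output z) = 0"
| "comm_bits (Bit1 f T T') = Suc (max (comm_bits T) (comm_bits T'))"
| "comm_bits (Bit2 g T T') = Suc (max (comm_bits T) (comm_bits T'))"

definition comm_solvable ::
    "nat \<Rightarrow> 'a set \<Rightarrow> 'b set \<Rightarrow> ('a \<Rightarrow> 'b \<Rightarrow> 'o \<Rightarrow> bool) \<Rightarrow> bool" where
  "comm_solvable t X Y Q \<longleftrightarrow>
     (\<exists>T. comm_bits T \<le> t \<and> (\<forall>x \<in> X. \<forall>y \<in> Y. Q x y (comm_run T x y)))"

section \<open>Monotone communication complexity of a set\<close>

text \<open>The first player holds \<open>(u, q)\<close> and the second \<open>(v, c)\<close>, for arbitrary \<open>u, v\<close> in \<open>{0,1}\<^sup>n\<close>.\<close>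

definition task1 :: "nat \<Rightarrow> nat \<Rightarrow> nat \<Rightarrow> bool list set \<Rightarrow> nat \<Rightarrow> bool" where
  "task1 n s r D t \<longleftrightarrow> comm_solvable t (cube n \<times> cube s) (cube n \<times> cube r)
     (\<lambda>(u, q) (v, c) z. z = (u @ q @ c \<in> D))"

definition task2 :: "nat \<Rightarrow> nat \<Rightarrow> nat \<Rightarrow> bool list set \<Rightarrow> nat \<Rightarrow> bool" where
  "task2 n s r D t \<longleftrightarrow> comm_solvable t (cube n \<times> cube s) (cube n \<times> cube r)
     (\<lambda>(u, q) (v, c) z. z = (v @ q @ c \<in> D))"

definition task3 :: "nat \<Rightarrow> nat \<Rightarrow> nat \<Rightarrow> bool list set \<Rightarrow> nat \<Rightarrow> bool" where
  "task3 n s r D t \<longleftrightarrow> comm_solvable t (cube n \<times> cube s) (cube n \<times> cube r)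
     (\<lambda>(u, q) (v, c) i. (u @ q @ c \<in> D) \<noteq> (v @ q @ c \<in> D) \<longrightarrow> i < n \<and> u ! i \<noteq> v ! i)"

text \<open>The output \<open>None\<close> stands for the decision that a suitable \<open>u' \<ge> u\<close> exists.\<close>

definition task4 :: "nat \<Rightarrow> nat \<Rightarrow> nat \<Rightarrow> bool list set \<Rightarrow> nat \<Rightarrow> bool" where
  "task4 n s r D t \<longleftrightarrow> comm_solvable t (cube n \<times> cube s) (cube n \<times> cube r)
     (\<lambda>(u, q) (v, c) z. u @ q @ c \<in> D \<and> v @ q @ c \<notin> D \<longrightarrow>
        (case z of
           Some i \<Rightarrow> i < n \<and> u ! i \<and> \<not> v ! i
         | None \<Rightarrow> \<exists>u' \<in> cube n. coord_le u u' \<and> u' @ q @ c \<notin> D))"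

definition set_CC :: "nat \<Rightarrow> nat \<Rightarrow> nat \<Rightarrow> bool list set \<Rightarrow> enat" where
  "set_CC n s r D = (INF t \<in> {t. task1 n s r D t \<and> task2 n s r D t \<and> task3 n s r D t}. enat t)"

definition set_MCC :: "nat \<Rightarrow> nat \<Rightarrow> nat \<Rightarrow> bool list set \<Rightarrow> enat" where
  "set_MCC n s r D = (INF t \<in> {t. set_CC n s r D \<le> enat t \<and> task4 n s r D t}. enat t)"

section \<open>Semantic refutations\<close>

text \<open>\<open>J i = None\<close> marks line \<open>i\<close> as one of the given sets, \<open>J i = Some (j\<^sub>1, j\<^sub>2)\<close> as inferred from
  the lines \<open>j\<^sub>1\<close> and \<open>j\<^sub>2\<close>.\<close>

definition derivation ::
    "'a set list \<Rightarrow> 'a set list \<Rightarrow> (nat \<Rightarrow> (nat \<times> nat) option) \<Rightarrow> bool" where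
  "derivation E D J \<longleftrightarrow> (\<forall>i < length D.
     case J i of
       None \<Rightarrow> D ! i \<in> set E
     | Some (j\<^sub>1, j\<^sub>2) \<Rightarrow> j\<^sub>1 < i \<and> j\<^sub>2 < i \<and> D ! j\<^sub>1 \<inter> D ! j\<^sub>2 \<subseteq> D ! i)"

definition premise_of :: "(nat \<Rightarrow> (nat \<times> nat) option) \<Rightarrow> nat \<Rightarrow> nat \<Rightarrow> bool" where
  "premise_of J j i \<longleftrightarrow> (\<exists>j\<^sub>1 j\<^sub>2. J i = Some (j\<^sub>1, j\<^sub>2) \<and> (j = j\<^sub>1 \<or> j = j\<^sub>2))"

definition semantic_refutation :: "'a set \<Rightarrow> 'a set list \<Rightarrow> 'a set list \<Rightarrow> bool" where
  "semantic_refutation X E D \<longleftrightarrow>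
     D \<noteq> [] \<and> set D \<subseteq> Pow X \<and> last D = {} \<and> (\<exists>J. derivation E D J)"

definition treelike_refutation :: "'a set \<Rightarrow> 'a set list \<Rightarrow> 'a set list \<Rightarrow> bool" where
  "treelike_refutation X E D \<longleftrightarrow>
     D \<noteq> [] \<and> set D \<subseteq> Pow X \<and> last D = {} \<and>
     (\<exists>J. derivation E D J \<and>
        (\<forall>j i i'. i < length D \<and> i' < length D \<and> premise_of J j i \<and> premise_of J j i' \<longrightarrow> i = i'))"

section \<open>Approximation\<close>

definition eps_approx :: "real \<Rightarrow> 'a set \<Rightarrow> 'a set \<Rightarrow> 'a set pmf \<Rightarrow> bool" where
  "eps_approx \<epsilon> \<Omega> X \<Y> \<longleftrightarrow>
     (\<forall>w \<in> \<Omega>. measure_pmf.prob \<Y> {Y. w \<in> (X - Y) \<union> (Y - X)} \<le> \<epsilon>)"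

section \<open>Protocols\<close>

definition KWm :: "nat \<Rightarrow> bool list set \<Rightarrow> bool list set \<Rightarrow> (bool list \<times> bool list \<times> nat) set" where
  "KWm n U V = {(u, v, i). u \<in> U \<and> v \<in> V \<and> i < n \<and> u ! i \<and> \<not> v ! i}"

record protocol =
  nodes :: "nat set"
  edges :: "(nat \<times> nat) set"
  root :: nat
  lab :: "nat \<Rightarrow> nat"
  consist :: "bool list \<Rightarrow> bool list \<Rightarrow> nat set"       \<comment> \<open>the sets \<open>F(u,v)\<close>\<close>
  strat :: "bool list \<Rightarrow> bool list \<Rightarrow> nat \<Rightarrow> nat"      \<comment> \<open>the strategy \<open>S(u,v,x)\<close>\<close>

definition leaves :: "protocol \<Rightarrow> nat set" where
  "leaves P = {x \<in> nodes P. \<nexists>y. (x, y) \<in> edges P}"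

definition inner_nodes :: "protocol \<Rightarrow> nat set" where
  "inner_nodes P = nodes P - leaves P"

definition is_protocol :: "bool list set \<Rightarrow> bool list set \<Rightarrow> nat set \<Rightarrow> protocol \<Rightarrow> bool" where
  "is_protocol U V I P \<longleftrightarrow>
     finite (nodes P) \<and> edges P \<subseteq> nodes P \<times> nodes P \<and> acyclic (edges P) \<and>
     {x \<in> nodes P. \<nexists>y. (y, x) \<in> edges P} = {root P} \<and>
     lab P ` leaves P \<subseteq> I \<and>
     (\<forall>u \<in> U. \<forall>v \<in> V. \<forall>x \<in> inner_nodes P. (x, strat P u v x) \<in> edges P) \<and>
     (\<forall>u \<in> U. \<forall>v \<in> V. consist P u v \<subseteq> nodes P \<and> root P \<in> consist P u v)"

definition protocol_CC :: "bool list set \<Rightarrow> bool list set \<Rightarrow> protocol \<Rightarrow> enat" where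
  "protocol_CC U V P = (INF t \<in> {t.
     (\<forall>x \<in> nodes P. comm_solvable t U V (\<lambda>u v z. z = (x \<in> consist P u v))) \<and>
     (\<forall>x \<in> inner_nodes P. comm_solvable t U V (\<lambda>u v y. y = strat P u v x))}. enat t)"

text \<open>Under the conditions of \<open>is_protocol\<close>, in-degree at most one means that the graph is a tree
  with root \<open>root P\<close>.\<close>

definition is_tree :: "protocol \<Rightarrow> bool" where
  "is_tree P \<longleftrightarrow> (\<forall>x x' y. (x, y) \<in> edges P \<and> (x', y) \<in> edges P \<longrightarrow> x = x')"

text \<open>A tree in which leaves may be shared, as the inputs of a formula are: duplicating every
  leaf for each of its incoming edges yields a tree.\<close>

definition is_tree_sharing_leaves :: "protocol \<Rightarrow> bool" where
  "is_tree_sharing_leaves P \<longleftrightarrow>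
     (\<forall>x x'. \<forall>y \<in> inner_nodes P. (x, y) \<in> edges P \<and> (x', y) \<in> edges P \<longrightarrow> x = x')"

definition random_protocol ::
    "bool list set \<Rightarrow> bool list set \<Rightarrow> nat set \<Rightarrow> (bool list \<times> bool list \<times> nat) set
       \<Rightarrow> real \<Rightarrow> protocol pmf \<Rightarrow> bool" where
  "random_protocol U V I R \<epsilon> \<P> \<longleftrightarrow>
     (\<forall>P \<in> set_pmf \<P>. is_protocol U V I P) \<and>
     (\<forall>u \<in> U. \<forall>v \<in> V.
        measure_pmf.prob \<P>
          {P. \<exists>x \<in> inner_nodes P. x \<in> consist P u v \<and> strat P u v x \<notin> consist P u v} \<le> \<epsilon> \<and>
        measure_pmf.prob \<P>
          {P. \<exists>x \<in> leaves P. x \<in> consist P u v \<and> (u, v, lab P x) \<notin> R} \<le> \<epsilon>)"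

definition random_size :: "protocol pmf \<Rightarrow> enat" where
  "random_size \<P> = (SUP P \<in> set_pmf \<P>. enat (card (nodes P)))"

text \<open>The size when leaves with the same label are counted once.\<close>

definition random_size_mod_labels :: "protocol pmf \<Rightarrow> enat" where
  "random_size_mod_labels \<P> =
     (SUP P \<in> set_pmf \<P>. enat (card (inner_nodes P) + card (lab P ` leaves P)))"

definition random_CC :: "bool list set \<Rightarrow> bool list set \<Rightarrow> protocol pmf \<Rightarrow> enat" where
  "random_CC U V \<P> = (SUP P \<in> set_pmf \<P>. protocol_CC U V P)"

end

theory Submission
  imports Defs
begin

text \<open>Fix witnesses \<open>q\<^sup>u\<close> and \<open>r\<^sup>v\<close> of \<open>u \<in> U\<close> and \<open>v \<in> V\<close>. The protocol walks from the last line of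
  the refutation backwards through lines that fail at \<open>(v, q\<^sup>u, r\<^sup>v)\<close>: soundness of an inference gives
  a failing premise, found by task 2. A walk cannot end in a line \<open>B\<^sub>j\<close>, and it ends in some \<open>C\<^sup>i\<close>
  only with probability \<open>\<epsilon>\<close>. In a line \<open>A\<^sub>j\<close>, which holds at \<open>(u', q\<^sup>u, r\<^sup>v)\<close> for all \<open>u' \<ge> u\<close>, task 4
  yields \<open>i\<close> with \<open>u\<^sub>i = 1\<close> and \<open>v\<^sub>i = 0\<close>, and the walk moves to a leaf labelled \<open>i\<close>.\<close>

section \<open>Communication trees\<close>

text \<open>The players of the protocol hold only \<open>u\<close> and \<open>v\<close>. Each can
  extend its input by a witness locally and post-process the output, so a tree for a task on a set
  is reused without spending a bit.\<close>

primrec comm_map :: "('c \<Rightarrow> 'a) \<Rightarrow> ('d \<Rightarrow> 'b) \<Rightarrow> ('o \<Rightarrow> 'p) \<Rightarrow> ('a, 'b, 'o) comm_tree \<Rightarrow>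
    ('c, 'd, 'p) comm_tree" where
  "comm_map f g h (Output z) = Output (h z)"
| "comm_map f g h (Bit1 p T T') = Bit1 (p \<circ> f) (comm_map f g h T) (comm_map f g h T')"
| "comm_map f g h (Bit2 p T T') = Bit2 (p \<circ> g) (comm_map f g h T) (comm_map f g h T')"

lemma comm_run_map [simp]: "comm_run (comm_map f g h T) x y = h (comm_run T (f x) (g y))"
  by (induction T) auto

lemma comm_bits_map [simp]: "comm_bits (comm_map f g h T) = comm_bits T"
  by (induction T) auto

lemma comm_solvable_mono: "comm_solvable t X Y Q \<Longrightarrow> t \<le> t' \<Longrightarrow> comm_solvable t' X Y Q"
  unfolding comm_solvable_def using order_trans by blast

lemma comm_solvable_map:
  assumes "comm_bits T \<le> t"
    and "\<And>x y. x \<in> X \<Longrightarrow> y \<in> Y \<Longrightarrow> Q x y (h (comm_run T (f x) (g y)))"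
  shows "comm_solvable t X Y Q"
  unfolding comm_solvable_def
  using assms by (intro exI[of _ "comm_map f g h T"]) auto

lemma comm_solvable_const:
  assumes "\<And>x y. x \<in> X \<Longrightarrow> y \<in> Y \<Longrightarrow> Q x y z"
  shows "comm_solvable t X Y Q"
  unfolding comm_solvable_def using assms by (intro exI[of _ "Output z"]) auto

lemma comm_solvable_and_not: "comm_solvable 2 X Y (\<lambda>x y z. z = (p x \<and> \<not> p' y))"
  unfolding comm_solvable_def
  by (intro exI[of _ "Bit1 p (Bit2 p' (Output False) (Output True)) (Output False)"]) auto

text \<open>A nonempty set of naturals attains its infimum and the empty infimum is infinite, so a
  finite bound is realised by an actual number of bits.\<close>

lemma INF_enat_leE:
  assumes "(INF i \<in> S. enat i) \<le> enat t"
  obtains i where "i \<in> S" "i \<le> t"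
proof (cases "S = {}")
  case True
  then show ?thesis using assms by (simp add: top_enat_def)
next
  case False
  then have "(INF i \<in> S. enat i) \<in> enat ` S"
    by (metis (no_types, lifting) Inf_enat_def LeastI_ex ex_in_conv image_is_empty)
  then show ?thesis using assms that by auto
qed

lemma set_MCC_leD:
  assumes "set_MCC n s r D \<le> enat t"
  shows "task1 n s r D t" "task2 n s r D t" "task4 n s r D t"
proof -
  obtain t0 where t0: "set_CC n s r D \<le> enat t0" "task4 n s r D t0" "t0 \<le> t"
    using assms unfolding set_MCC_def by (elim INF_enat_leE) auto
  obtain t1 where t1: "task1 n s r D t1" "task2 n s r D t1" "t1 \<le> t0"
    using t0(1) unfolding set_CC_def by (elim INF_enat_leE) auto
  from t0 t1 show "task1 n s r D t" "task2 n s r D t" "task4 n s r D t"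
    unfolding task1_def task2_def task4_def using comm_solvable_mono order_trans by blast+
qed

text \<open>A tree without bits is a single output, so its answer cannot depend on the inputs. This
  will exclude \<open>t = 0\<close> once a line separates \<open>u\<close> from
  \<open>v\<close>.\<close>

lemma task1_0D:
  assumes "task1 n s r D 0" "u \<in> cube n" "u' \<in> cube n" "q \<in> cube s" "c \<in> cube r"
  shows "u @ q @ c \<in> D \<longleftrightarrow> u' @ q @ c \<in> D"
proof -
  obtain T where T: "comm_bits T = 0"
    "\<And>u q v c. \<lbrakk>u \<in> cube n; q \<in> cube s; v \<in> cube n; c \<in> cube r\<rbrakk> \<Longrightarrow>
       comm_run T (u, q) (v, c) = (u @ q @ c \<in> D)"
    using assms(1) unfolding task1_def comm_solvable_def by auto
  obtain z where "T = Output z" using T(1) by (cases T) auto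
  then show ?thesis using T(2)[of u q u c] T(2)[of u' q u c] assms by simp
qed

section \<open>The protocol of a refutation\<close>

text \<open>One fixed choice per input: a player finds its own witness without communication, and
  the point followed by the walk depends on \<open>(u, v)\<close> alone.\<close>

definition proj_witness :: "nat \<Rightarrow> bool list set list \<Rightarrow> bool list \<Rightarrow> bool list" where
  "proj_witness d As u = (SOME b. b \<in> cube d \<and> (\<forall>A \<in> set As. u @ b \<in> A))"

lemma proj_witness:
  assumes "u \<in> proj_set n d As"
  shows "u \<in> cube n" "proj_witness d As u \<in> cube d" "A \<in> set As \<Longrightarrow> u @ proj_witness d As u \<in> A"
  using assms someI_ex[of "\<lambda>b. b \<in> cube d \<and> (\<forall>A \<in> set As. u @ b \<in> A)"]
  unfolding proj_set_def proj_witness_def by auto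

lemma mem_cyl_A:
  assumes "a \<in> cube n" "b \<in> cube s" "c \<in> cube r"
  shows "a @ b @ c \<in> cyl_A n s r A \<longleftrightarrow> a @ b \<in> A"
  using assms unfolding cyl_A_def cube_def by auto

lemma mem_cyl_B:
  assumes "a \<in> cube n" "b \<in> cube s" "c \<in> cube r"
  shows "a @ b @ c \<in> cyl_B n s r B \<longleftrightarrow> a @ c \<in> B"
  using assms unfolding cyl_B_def cube_def by auto

text \<open>Nodes below \<open>length D\<close> are the lines of the refutation \<open>D\<close>, and a node \<open>y \<ge> length D\<close> is a leaf
  with label \<open>(y - length D) mod n\<close>. For \<open>m = 0\<close> the lines share \<open>n\<close> such leaves, for \<open>m = 1\<close> each line
  has \<open>n\<close> leaves of its own.\<close>

locale monotone_refutation =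
  fixes n s r :: nat and As Bs Cs :: "bool list set list" and D :: "bool list set list"
    and J :: "nat \<Rightarrow> (nat \<times> nat) option" and t m :: nat
  assumes n_pos: "n \<ge> 1"
    and monotone: "\<And>u u' b. u \<in> cube n \<Longrightarrow> u' \<in> cube n \<Longrightarrow> b \<in> cube s \<Longrightarrow>
      \<forall>A \<in> set As. u @ b \<in> A \<Longrightarrow> coord_le u u' \<Longrightarrow> \<forall>A \<in> set As. u' @ b \<in> A"
    and D_nonempty: "D \<noteq> []" and last_D: "last D = {}"
    and deriv: "derivation (map (cyl_A n s r) As @ map (cyl_B n s r) Bs @ Cs) D J"
    and MCC: "\<And>X. X \<in> set D \<Longrightarrow> set_MCC n s r X \<le> enat t"
begin

abbreviation "U \<equiv> proj_set n s As"
abbreviation "V \<equiv> proj_set n r Bs"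

text \<open>Only axioms count. An inferred line that happens to equal a cylinder is left through its
  premises.\<close>

definition A_line :: "nat \<Rightarrow> bool" where
  "A_line x \<longleftrightarrow> x < length D \<and> J x = None \<and> D ! x \<in> cyl_A n s r ` set As"

definition leaf_node :: "nat \<Rightarrow> nat \<Rightarrow> nat" where
  "leaf_node x i = length D + m * x * n + i"

text \<open>Edges run against the derivation, from a line to its premises, and from an axiom A_j to
  leaves for the possible answers of task 4.\<close>

definition all_edges :: "(nat \<times> nat) set" where
  "all_edges = {(x, y). x < length D \<and> premise_of J y x} \<union>
     {(x, leaf_node x i) | x i. A_line x \<and> i < n}"

text \<open>Discarding all other nodes makes the last line the only source.\<close>

definition reach :: "nat set" where
  "reach = {x. (length D - 1, x) \<in> all_edges\<^sup>*}"

definition point :: "bool list \<Rightarrow> bool list \<Rightarrow> bool list" where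
  "point u v = v @ proj_witness s As u @ proj_witness r Bs v"

text \<open>Axioms that are not A-lines are leaves as well; they receive the default label 0, which
  lies in [n] because \<open>n\<close> is positive.\<close>

definition label :: "nat \<Rightarrow> nat" where
  "label x = (if x < length D then 0 else (x - length D) mod n)"

text \<open>For \<open>t = 0\<close> the players cannot recognise the label of a leaf, but then every line is empty or the
  whole cube, so that the walk never moves to a leaf and the leaves can be left out of \<open>F(u,v)\<close>.\<close>

definition in_F :: "bool list \<Rightarrow> bool list \<Rightarrow> nat \<Rightarrow> bool" where
  "in_F u v x \<longleftrightarrow> (if x < length D then point u v \<notin> D ! x
     else t > 0 \<and> u ! label x \<and> \<not> v ! label x)"

definition tree4 :: "nat \<Rightarrow> (bool list \<times> bool list, bool list \<times> bool list, nat option) comm_tree" where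
  "tree4 x = (SOME T. comm_bits T \<le> t \<and>
     (\<forall>u \<in> cube n. \<forall>q \<in> cube s. \<forall>v \<in> cube n. \<forall>c \<in> cube r.
        u @ q @ c \<in> D ! x \<and> v @ q @ c \<notin> D ! x \<longrightarrow>
        (case comm_run T (u, q) (v, c) of
           Some i \<Rightarrow> i < n \<and> u ! i \<and> \<not> v ! i
         | None \<Rightarrow> \<exists>u' \<in> cube n. coord_le u u' \<and> u' @ q @ c \<notin> D ! x)))"

text \<open>The strategy must follow an edge on every input, also where task 4 promises nothing;
  \<open>None\<close> and indices beyond [n] are therefore sent to arbitrary legal leaves.\<close>

fun leaf_index :: "nat option \<Rightarrow> nat" where
  "leaf_index None = 0"
| "leaf_index (Some i) = i mod n"

text \<open>Testing the first premise suffices: if it holds at the point while the conclusion fails,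
  soundness makes the second one fail.\<close>

definition step :: "bool list \<Rightarrow> bool list \<Rightarrow> nat \<Rightarrow> nat" where
  "step u v x = (case J x of
      Some (j\<^sub>1, j\<^sub>2) \<Rightarrow> if point u v \<notin> D ! j\<^sub>1 then j\<^sub>1 else j\<^sub>2
    | None \<Rightarrow> leaf_node x (leaf_index
        (comm_run (tree4 x) (u, proj_witness s As u) (v, proj_witness r Bs v))))"

definition proto :: protocol where
  "proto = \<lparr>nodes = reach, edges = all_edges \<inter> reach \<times> reach, root = length D - 1, lab = label,
     consist = (\<lambda>u v. {x \<in> reach. in_F u v x}), strat = step\<rparr>"

lemma tree4:
  assumes "x < length D"
  shows "comm_bits (tree4 x) \<le> t"
    and "\<lbrakk>u \<in> cube n; q \<in> cube s; v \<in> cube n; c \<in> cube r; u @ q @ c \<in> D ! x; v @ q @ c \<notin> D ! x\<rbrakk> \<Longrightarrow>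
      (case comm_run (tree4 x) (u, q) (v, c) of
         Some i \<Rightarrow> i < n \<and> u ! i \<and> \<not> v ! i
       | None \<Rightarrow> \<exists>u' \<in> cube n. coord_le u u' \<and> u' @ q @ c \<notin> D ! x)"
proof -
  have "task4 n s r (D ! x) t"
    using MCC[of "D ! x"] set_MCC_leD(3) assms by simp
  then have "\<exists>T. comm_bits T \<le> t \<and>
     (\<forall>u \<in> cube n. \<forall>q \<in> cube s. \<forall>v \<in> cube n. \<forall>c \<in> cube r.
        u @ q @ c \<in> D ! x \<and> v @ q @ c \<notin> D ! x \<longrightarrow>
        (case comm_run T (u, q) (v, c) of
           Some i \<Rightarrow> i < n \<and> u ! i \<and> \<not> v ! i
         | None \<Rightarrow> \<exists>u' \<in> cube n. coord_le u u' \<and> u' @ q @ c \<notin> D ! x))"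
    unfolding task4_def comm_solvable_def by simp
  from someI_ex[OF this, folded tree4_def]
  show "comm_bits (tree4 x) \<le> t"
    and "\<lbrakk>u \<in> cube n; q \<in> cube s; v \<in> cube n; c \<in> cube r; u @ q @ c \<in> D ! x; v @ q @ c \<notin> D ! x\<rbrakk> \<Longrightarrow>
      (case comm_run (tree4 x) (u, q) (v, c) of
         Some i \<Rightarrow> i < n \<and> u ! i \<and> \<not> v ! i
       | None \<Rightarrow> \<exists>u' \<in> cube n. coord_le u u' \<and> u' @ q @ c \<notin> D ! x)"
    by auto
qed

section \<open>The graph: acyclicity, reachable nodes, leaves\<close>

lemma premise_less: "x < length D \<Longrightarrow> premise_of J y x \<Longrightarrow> y < x"
  using deriv unfolding derivation_def premise_of_def by fastforce

lemma all_edges_less: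
  assumes "(x, y) \<in> all_edges"
  shows "x < length D" "y < x \<or> length D \<le> y"
  using assms premise_less unfolding all_edges_def A_line_def leaf_node_def by auto

lemma acyclic_all_edges: "acyclic all_edges"
proof -
  \<comment> \<open>An edge leads to an earlier line or to a node beyond the lines, so this rank
    drops along it.\<close>
  have "all_edges\<inverse> \<subseteq> Wellfounded.measure (\<lambda>x. if x < length D then Suc x else 0)"
    using all_edges_less by (fastforce split: if_splits)
  then show ?thesis
    using wf_acyclic wf_measure wf_subset acyclic_converse by metis
qed

lemma root_in_reach: "length D - 1 \<in> reach"
  unfolding reach_def by simp

lemma reach_step: "x \<in> reach \<Longrightarrow> (x, y) \<in> all_edges \<Longrightarrow> y \<in> reach"
  unfolding reach_def by (auto intro: rtrancl_into_rtrancl)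

lemma reach_subset: "reach \<subseteq> {..<length D} \<union> {leaf_node x i | x i. x < length D \<and> i < n}"
proof
  fix y assume "y \<in> reach"
  then have "(length D - 1, y) \<in> all_edges\<^sup>*" unfolding reach_def by simp
  then show "y \<in> {..<length D} \<union> {leaf_node x i | x i. x < length D \<and> i < n}"
  proof (cases rule: rtrancl.cases)
    case rtrancl_refl
    then show ?thesis using D_nonempty by simp
  next
    case (rtrancl_into_rtrancl b)
    then show ?thesis using premise_less[of b y] unfolding all_edges_def A_line_def by auto
  qed
qed

lemma finite_reach: "finite reach"
proof (rule finite_subset[OF reach_subset])
  have "{leaf_node x i | x i. x < length D \<and> i < n} = case_prod leaf_node ` ({..<length D} \<times> {..<n})"
    by force
  then show "finite ({..<length D} \<union> {leaf_node x i | x i. x < length D \<and> i < n})" by simp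
qed

text \<open>Inferences have premises and an A-line has n \<ge> 1 successors. \<open>reach\<close> is
  closed under edges, so restricting the graph to it creates no new leaves.\<close>

lemma leaves_proto:
  "leaves proto = {x \<in> reach. length D \<le> x \<or> (J x = None \<and> \<not> A_line x)}"
proof -
  have "(\<exists>y. (x, y) \<in> all_edges) \<longleftrightarrow> x < length D \<and> (J x \<noteq> None \<or> A_line x)" for x
    unfolding all_edges_def premise_of_def using n_pos by (fastforce simp: A_line_def)
  moreover have "leaves proto = {x \<in> reach. \<nexists>y. (x, y) \<in> all_edges}"
    using reach_step unfolding leaves_def proto_def by auto
  ultimately show ?thesis by (simp add: not_less del: not_None_eq)
qed

lemma inner_nodes_proto:
  "inner_nodes proto = {x \<in> reach. x < length D \<and> (J x \<noteq> None \<or> A_line x)}"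
  unfolding inner_nodes_def leaves_proto unfolding proto_def by (auto simp: not_le)

lemma label_less: "label x < n"
  using n_pos unfolding label_def by simp

lemma leaf_index_less: "leaf_index z < n"
  using n_pos by (cases z) auto

lemma label_leaf_node: "i < n \<Longrightarrow> label (leaf_node x i) = i"
  unfolding label_def leaf_node_def by simp

lemma step_edge:
  assumes "x \<in> inner_nodes proto"
  shows "(x, step u v x) \<in> edges proto"
proof -
  have x: "x \<in> reach" "x < length D" "J x \<noteq> None \<or> A_line x"
    using assms unfolding inner_nodes_proto by auto
  have "(x, step u v x) \<in> all_edges"
  proof (cases "J x")
    case None
    then show ?thesis using x leaf_index_less unfolding step_def all_edges_def by auto
  next
    case (Some p)
    then show ?thesis using x unfolding step_def all_edges_def premise_of_def
      by (cases p) auto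
  qed
  then show ?thesis using x reach_step unfolding proto_def by auto
qed

lemma is_protocol_proto: "is_protocol U V {..<n} proto"
proof -
  have "acyclic (edges proto)"
    using acyclic_all_edges acyclic_subset unfolding proto_def by (metis Int_lower1 protocol.select_convs(2))
  moreover have "{x \<in> nodes proto. \<nexists>y. (y, x) \<in> edges proto} = {root proto}"
  proof (intro equalityI subsetI)
    fix x assume "x \<in> {x \<in> nodes proto. \<nexists>y. (y, x) \<in> edges proto}"
    then have x: "(length D - 1, x) \<in> all_edges\<^sup>*" "\<And>y. (y, x) \<in> all_edges \<Longrightarrow> y \<notin> reach"
      using reach_step unfolding proto_def reach_def by auto
    \<comment> \<open>A nonempty path to \<open>x\<close> ends in an edge whose tail is reachable
      too, which \<open>x(2)\<close> forbids.\<close>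
    from x(1) show "x \<in> {root proto}"
      by (cases rule: rtrancl.cases) (use x(2) in \<open>auto simp: proto_def reach_def\<close>)
  next
    fix x assume "x \<in> {root proto}"
    \<comment> \<open>Such an edge would start at a line later than the last one.\<close>
    moreover have "(y, length D - 1) \<notin> all_edges" for y
      using all_edges_less[of y "length D - 1"] D_nonempty by (auto simp: Suc_le_eq)
    ultimately show "x \<in> {x \<in> nodes proto. \<nexists>y. (y, x) \<in> edges proto}"
      using root_in_reach unfolding proto_def by auto
  qed
  \<comment> \<open>The last line is empty, hence fails at every point.\<close>
  moreover have "in_F u v (length D - 1)" for u v
    using D_nonempty last_D unfolding in_F_def by (simp add: last_conv_nth)
  moreover have "(x, strat proto u v x) \<in> edges proto" if "x \<in> inner_nodes proto" for u v x
    using step_edge[OF that] unfolding proto_def by simp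
  ultimately show ?thesis
    using finite_reach label_less root_in_reach unfolding is_protocol_def
    by (auto simp: proto_def)
qed

section \<open>Consistency of the walk and correctness of the leaves\<close>

lemma A_line_mem:
  assumes "A_line x" "u \<in> U" "c \<in> cube r" "u' \<in> cube n" "coord_le u u'"
  shows "u' @ proj_witness s As u @ c \<in> D ! x"
proof -
  note w = proj_witness[OF assms(2)]
  \<comment> \<open>By the monotonicity condition the witness of \<open>u\<close> serves every
    \<open>u'\<close> above \<open>u\<close>. This will contradict the answer \<open>None\<close> of
    task 4.\<close>
  have "\<forall>A \<in> set As. u' @ proj_witness s As u \<in> A"
    using monotone[of u u' "proj_witness s As u"] w assms by blast
  then show ?thesis
    using assms w(2) unfolding A_line_def by (auto simp: mem_cyl_A)
qed

lemma coord_le_refl: "coord_le u u"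
  unfolding coord_le_def by (simp add: list_all2_refl)

lemma A_line_step:
  assumes x: "A_line x" and u: "u \<in> U" and v: "v \<in> V" and F: "point u v \<notin> D ! x"
  shows "in_F u v (step u v x)"
proof -
  define q c where qc: "q = proj_witness s As u" "c = proj_witness r Bs v"
  have xl: "x < length D" "J x = None" using x unfolding A_line_def by auto
  have mem: "u \<in> cube n" "q \<in> cube s" "v \<in> cube n" "c \<in> cube r"
    using proj_witness[OF u] proj_witness[OF v] unfolding qc by auto
  have inD: "u' @ q @ c \<in> D ! x" if "u' \<in> cube n" "coord_le u u'" for u'
    using A_line_mem x u mem that unfolding qc by blast
  have notD: "v @ q @ c \<notin> D ! x" using F unfolding point_def qc .
  have "case comm_run (tree4 x) (u, q) (v, c) of
         Some i \<Rightarrow> i < n \<and> u ! i \<and> \<not> v ! i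
       | None \<Rightarrow> \<exists>u' \<in> cube n. coord_le u u' \<and> u' @ q @ c \<notin> D ! x"
    using tree4(2) xl mem inD[OF mem(1) coord_le_refl] notD by blast
  \<comment> \<open>\<open>None\<close> would give some \<open>u'\<close> above \<open>u\<close>
    with \<open>(u', q, c)\<close> outside the line, against \<open>inD\<close>.\<close>
  then obtain i where i: "comm_run (tree4 x) (u, q) (v, c) = Some i" "i < n" "u ! i" "\<not> v ! i"
    using inD by (auto split: option.splits)
  have "task1 n s r (D ! x) t"
    using MCC[of "D ! x"] set_MCC_leD(1) xl by simp
  \<comment> \<open>The line contains \<open>(u, q, c)\<close> and misses \<open>(v, q, c)\<close>,
    so membership cannot be decided with zero bits. Hence the guard \<open>t > 0\<close> in
    \<open>in_F\<close> is met.\<close>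
  then have "t > 0"
    using task1_0D[of n s r "D ! x" u v q c] inD[OF mem(1) coord_le_refl] notD mem
    by (cases t) auto
  moreover have "step u v x = leaf_node x i"
    using i xl unfolding step_def qc by simp
  moreover have "\<not> leaf_node x i < length D"
    unfolding leaf_node_def by simp
  ultimately show ?thesis
    using i label_leaf_node unfolding in_F_def by simp
qed

text \<open>This involves no assumption on the sets \<open>Cs\<close>, so the first kind of error
  has probability 0.\<close>

lemma step_consistent:
  assumes "u \<in> U" "v \<in> V" "x \<in> inner_nodes proto" "x \<in> consist proto u v"
  shows "strat proto u v x \<in> consist proto u v"
proof -
  have x: "x \<in> reach" "x < length D" "J x \<noteq> None \<or> A_line x"
    using assms unfolding inner_nodes_proto by auto
  have F: "point u v \<notin> D ! x"
    using assms(4) x unfolding proto_def in_F_def by simp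
  have "in_F u v (step u v x)"
  proof (cases "J x")
    case None
    then show ?thesis using A_line_step assms x F by blast
  next
    case (Some p)
    obtain j\<^sub>1 j\<^sub>2 where p: "p = (j\<^sub>1, j\<^sub>2)" by fastforce
    have "j\<^sub>1 < x \<and> j\<^sub>2 < x \<and> D ! j\<^sub>1 \<inter> D ! j\<^sub>2 \<subseteq> D ! x"
      using deriv x(2) Some p unfolding derivation_def by fastforce
    then show ?thesis using F x(2) Some p unfolding in_F_def step_def by auto
  qed
  then show ?thesis
    using step_edge[OF assms(3), of u v] unfolding proto_def by auto
qed

text \<open>A leaf that is a line failing at the point would be some B_j or C^i. The former contains
  the point because it reads only \<open>v\<close> and its witness, the latter by the last
  assumption. Other leaves enter F only with a valid label.\<close>

lemma leaf_correct:
  assumes "u \<in> U" "v \<in> V" "x \<in> leaves proto" "x \<in> consist proto u v" "point u v \<in> \<Inter> (set Cs)"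
  shows "(u, v, lab proto x) \<in> KWm n U V"
proof (cases "x < length D")
  case True
  have x: "J x = None" "\<not> A_line x" "point u v \<notin> D ! x"
    using True assms(3,4) unfolding leaves_proto by (auto simp: proto_def in_F_def)
  have "D ! x \<in> set (map (cyl_A n s r) As @ map (cyl_B n s r) Bs @ Cs)"
    using deriv True x(1) unfolding derivation_def by fastforce
  then consider B where "B \<in> set Bs" "D ! x = cyl_B n s r B" | "D ! x \<in> set Cs"
    using x True unfolding A_line_def by auto
  then show ?thesis
  proof cases
    case 1
    then have "point u v \<in> D ! x"
      using proj_witness[OF assms(1)] proj_witness[OF assms(2)]
      unfolding point_def by (simp add: mem_cyl_B)
    then show ?thesis using x by simp
  next
    case 2
    then show ?thesis using x assms(5) by blast
  qed
next
  case False
  then show ?thesis using assms label_less unfolding KWm_def proto_def in_F_def by simp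
qed

section \<open>Communication cost\<close>

lemma line_decidable:
  assumes "x < length D"
  shows "\<exists>T. comm_bits T \<le> t \<and> (\<forall>u \<in> U. \<forall>v \<in> V.
    comm_run T (u, proj_witness s As u) (v, proj_witness r Bs v) = (point u v \<in> D ! x))"
proof -
  have "task2 n s r (D ! x) t"
    using MCC[of "D ! x"] set_MCC_leD(2) assms by simp
  then obtain T where T: "comm_bits T \<le> t"
    "\<And>u q v c. \<lbrakk>u \<in> cube n; q \<in> cube s; v \<in> cube n; c \<in> cube r\<rbrakk> \<Longrightarrow>
       comm_run T (u, q) (v, c) = (v @ q @ c \<in> D ! x)"
    unfolding task2_def comm_solvable_def by auto
  then show ?thesis
    using proj_witness(1,2) unfolding point_def by blast
qed

lemma consist_solvable:
  assumes "x \<in> nodes proto"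
  shows "comm_solvable (2 * t) U V (\<lambda>u v z. z = (x \<in> consist proto u v))"
proof -
  have *: "x \<in> consist proto u v \<longleftrightarrow> in_F u v x" for u v
    using assms unfolding proto_def by simp
  consider "x < length D" | "\<not> x < length D" "t = 0" | "\<not> x < length D" "t > 0" by blast
  then show ?thesis
  proof cases
    case 1
    then obtain T where T: "comm_bits T \<le> t" "\<And>u v. u \<in> U \<Longrightarrow> v \<in> V \<Longrightarrow>
      comm_run T (u, proj_witness s As u) (v, proj_witness r Bs v) = (point u v \<in> D ! x)"
      using line_decidable by meson
    show ?thesis
      by (rule comm_solvable_map[where T = T and h = Not and
            f = "\<lambda>u. (u, proj_witness s As u)" and g = "\<lambda>v. (v, proj_witness r Bs v)"])
        (use T 1 in \<open>auto simp: * in_F_def\<close>)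
  next
    case 2
    then have "\<not> in_F u v x" for u v unfolding in_F_def by simp
    then show ?thesis by (intro comm_solvable_const[where z = False]) (simp add: *)
  next
    case 3
    then have "comm_solvable 2 U V (\<lambda>u v z. z = (x \<in> consist proto u v))"
      using comm_solvable_and_not[of U V "\<lambda>u. u ! label x" "\<lambda>v. v ! label x"]
      by (simp add: * in_F_def)
    \<comment> \<open>Checking u_i = 1 and v_i = 0 costs two bits, at most \<open>2 * t\<close>
      since \<open>t\<close> is positive; this is the source of the factor 2.\<close>
    then show ?thesis using 3 by (elim comm_solvable_mono) simp
  qed
qed

lemma strat_solvable:
  assumes "x \<in> inner_nodes proto"
  shows "comm_solvable (2 * t) U V (\<lambda>u v y. y = strat proto u v x)"
proof -
  have x: "x < length D" using assms unfolding inner_nodes_proto by auto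
  have *: "strat proto u v x = step u v x" for u v
    unfolding proto_def by simp
  show ?thesis
  proof (cases "J x")
    case None
    show ?thesis
      by (rule comm_solvable_map[where T = "tree4 x" and h = "\<lambda>z. leaf_node x (leaf_index z)" and
            f = "\<lambda>u. (u, proj_witness s As u)" and g = "\<lambda>v. (v, proj_witness r Bs v)"])
        (use tree4(1)[OF x] None in \<open>auto simp: * step_def\<close>)
  next
    case (Some p)
    obtain j\<^sub>1 j\<^sub>2 where p: "p = (j\<^sub>1, j\<^sub>2)" by fastforce
    have "j\<^sub>1 < length D"
      using premise_less[OF x, of j\<^sub>1] Some p x unfolding premise_of_def by auto
    then obtain T where T: "comm_bits T \<le> t" "\<And>u v. u \<in> U \<Longrightarrow> v \<in> V \<Longrightarrow>
      comm_run T (u, proj_witness s As u) (v, proj_witness r Bs v) = (point u v \<in> D ! j\<^sub>1)"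
      using line_decidable by meson
    show ?thesis
      by (rule comm_solvable_map[where T = T and h = "\<lambda>z. if \<not> z then j\<^sub>1 else j\<^sub>2" and
            f = "\<lambda>u. (u, proj_witness s As u)" and g = "\<lambda>v. (v, proj_witness r Bs v)"])
        (use T Some p in \<open>auto simp: * step_def\<close>)
  qed
qed

lemma protocol_CC_proto: "protocol_CC U V proto \<le> enat (2 * t)"
  unfolding protocol_CC_def using consist_solvable strat_solvable by (intro INF_lower) blast

section \<open>Size and tree shape\<close>

lemma card_nodes_proto:
  assumes "m = 0"
  shows "card (nodes proto) \<le> length D + n"
proof -
  have "nodes proto \<subseteq> {..<length D + n}"
    using reach_subset assms unfolding proto_def leaf_node_def by auto
  then show ?thesis using card_mono[of "{..<length D + n}"] by fastforce
qed

text \<open>Independent of \<open>m\<close>: private copies of a leaf carry the same label and count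
  once.\<close>

lemma card_inner_labels_proto:
  "card (inner_nodes proto) + card (lab proto ` leaves proto) \<le> length D + n"
proof -
  have "inner_nodes proto \<subseteq> {..<length D}" unfolding inner_nodes_proto by auto
  moreover have "lab proto ` leaves proto \<subseteq> {..<n}"
    using label_less unfolding proto_def by auto
  ultimately show ?thesis
    using card_mono[of "{..<length D}" "inner_nodes proto"]
      card_mono[of "{..<n}" "lab proto ` leaves proto"] by simp
qed

text \<open>Leaf nodes are numbered from \<open>length D\<close> on, so an edge into a line comes
  from an inference.\<close>

lemma line_edge:
  assumes "(x, y) \<in> edges proto" "y < length D"
  shows "x < length D" "premise_of J y x"
  using assms unfolding proto_def all_edges_def leaf_node_def by auto

lemma is_tree_sharing_leaves_proto:
  assumes "\<And>j i i'. \<lbrakk>i < length D; i' < length D; premise_of J j i; premise_of J j i'\<rbrakk> \<Longrightarrow> i = i'"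
  shows "is_tree_sharing_leaves proto"
  unfolding is_tree_sharing_leaves_def inner_nodes_proto using line_edge assms by blast

lemma is_tree_proto:
  assumes "\<And>j i i'. \<lbrakk>i < length D; i' < length D; premise_of J j i; premise_of J j i'\<rbrakk> \<Longrightarrow> i = i'"
    and "m = 1"
  shows "is_tree proto"
  unfolding is_tree_def
proof (intro allI impI)
  fix x x' y assume e: "(x, y) \<in> edges proto \<and> (x', y) \<in> edges proto"
  show "x = x'"
  proof (cases "y < length D")
    case True
    then show ?thesis using e line_edge assms(1) by blast
  next
    case False
    \<comment> \<open>Here \<open>y - length D\<close> is \<open>z * n + i\<close> with
      \<open>i < n\<close>, so a private leaf determines its line.\<close>
    have "z = (y - length D) div n" if "(z, y) \<in> edges proto" for z
      using that False premise_less[of z y] n_pos assms(2)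
      unfolding proto_def all_edges_def leaf_node_def by auto
    then show ?thesis using e by blast
  qed
qed

end

section \<open>Randomization\<close>

text \<open>Both variables are functions of the same sample, so an implication between the events on
  the support suffices.\<close>

lemma prob_map_pmf_mono:
  assumes "\<And>x. x \<in> set_pmf p \<Longrightarrow> f x \<in> S \<Longrightarrow> g x \<in> S'"
  shows "measure_pmf.prob (map_pmf f p) S \<le> measure_pmf.prob (map_pmf g p) S'"
  unfolding measure_map_pmf
  by (rule measure_pmf.finite_measure_mono_AE) (use assms in \<open>auto simp: AE_measure_pmf_iff\<close>)

lemma random_protocol_of_refutations:
  fixes \<epsilon> :: real and \<C> :: "bool list set list pmf" and m :: nat
  assumes ref: "\<And>Cs. Cs \<in> set_pmf \<C> \<Longrightarrow> monotone_refutation n s r As Bs Cs (\<pi> Cs) (J Cs) t"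
    and approx: "eps_approx \<epsilon> (cube (n + s + r)) (cube (n + s + r)) (map_pmf (\<lambda>Cs. \<Inter> (set Cs)) \<C>)"
    and "\<epsilon> > 0"
  defines "U \<equiv> proj_set n s As" and "V \<equiv> proj_set n r Bs"
    and "\<P> \<equiv> map_pmf (\<lambda>Cs. monotone_refutation.proto n s r As Bs (\<pi> Cs) (J Cs) t m) \<C>"
  shows "random_protocol U V {..<n} (KWm n U V) \<epsilon> \<P>" and "random_CC U V \<P> \<le> enat (2 * t)"
proof -
  let ?f = "\<lambda>Cs. monotone_refutation.proto n s r As Bs (\<pi> Cs) (J Cs) t m"
  have cc: "protocol_CC U V P \<le> enat (2 * t)" and pr: "is_protocol U V {..<n} P" if "P \<in> set_pmf \<P>" for P
    using that monotone_refutation.protocol_CC_proto[OF ref] monotone_refutation.is_protocol_proto[OF ref]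
    unfolding \<P>_def U_def V_def by auto
  show "random_CC U V \<P> \<le> enat (2 * t)"
    unfolding random_CC_def using cc by (rule SUP_least)
  have "measure_pmf.prob \<P>
          {P. \<exists>x \<in> inner_nodes P. x \<in> consist P u v \<and> strat P u v x \<notin> consist P u v} \<le> \<epsilon> \<and>
        measure_pmf.prob \<P>
          {P. \<exists>x \<in> leaves P. x \<in> consist P u v \<and> (u, v, lab P x) \<notin> KWm n U V} \<le> \<epsilon>"
    if u: "u \<in> U" and v: "v \<in> V" for u v
  proof
    \<comment> \<open>No sample of the support produces this event, hence the comparison with the
      empty event.\<close>
    have "measure_pmf.prob \<P>
          {P. \<exists>x \<in> inner_nodes P. x \<in> consist P u v \<and> strat P u v x \<notin> consist P u v}
        \<le> measure_pmf.prob (map_pmf (\<lambda>Cs. \<Inter> (set Cs)) \<C>) {}"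
      unfolding \<P>_def
      by (rule prob_map_pmf_mono)
        (use monotone_refutation.step_consistent[OF ref] u v in \<open>auto simp: U_def V_def\<close>)
    then show "measure_pmf.prob \<P>
          {P. \<exists>x \<in> inner_nodes P. x \<in> consist P u v \<and> strat P u v x \<notin> consist P u v} \<le> \<epsilon>"
      using \<open>\<epsilon> > 0\<close> by simp
    \<comment> \<open>The point depends on \<open>(u, v)\<close> and not on the sample, so the
      approximation hypothesis applies to it.\<close>
    define w where "w = v @ proj_witness s As u @ proj_witness r Bs v"
    have w: "w \<in> cube (n + s + r)"
      using proj_witness[of u n s As] proj_witness[of v n r Bs] u v
      unfolding w_def U_def V_def cube_def by simp
    have "measure_pmf.prob \<P>
          {P. \<exists>x \<in> leaves P. x \<in> consist P u v \<and> (u, v, lab P x) \<notin> KWm n U V}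
        \<le> measure_pmf.prob (map_pmf (\<lambda>Cs. \<Inter> (set Cs)) \<C>)
          {Y. w \<in> (cube (n + s + r) - Y) \<union> (Y - cube (n + s + r))}"
      unfolding \<P>_def
    proof (rule prob_map_pmf_mono)
      fix Cs assume Cs: "Cs \<in> set_pmf \<C>"
        and bad: "?f Cs \<in> {P. \<exists>x \<in> leaves P. x \<in> consist P u v \<and> (u, v, lab P x) \<notin> KWm n U V}"
      interpret monotone_refutation n s r As Bs Cs "\<pi> Cs" "J Cs" t m
        using ref[OF Cs] .
      \<comment> \<open>By contraposition of \<open>leaf_correct\<close>, a wrong leaf in F forces
        some C^i to miss the point.\<close>
      have "w \<notin> \<Inter> (set Cs)"
        using bad leaf_correct u v unfolding w_def U_def V_def point_def by blast
      then show "\<Inter> (set Cs) \<in> {Y. w \<in> (cube (n + s + r) - Y) \<union> (Y - cube (n + s + r))}"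
        using w by blast
    qed
    also have "\<dots> \<le> \<epsilon>" using approx w unfolding eps_approx_def by blast
    finally show "measure_pmf.prob \<P>
          {P. \<exists>x \<in> leaves P. x \<in> consist P u v \<and> (u, v, lab P x) \<notin> KWm n U V} \<le> \<epsilon>" .
  qed
  with pr show "random_protocol U V {..<n} (KWm n U V) \<epsilon> \<P>"
    unfolding random_protocol_def by blast
qed

text \<open>The tree-like claim takes two forms. A protocol sharing its leaves meets the size bounds
  in nodes. A genuine tree, in which the construction may give each A-line n leaves of its own,
  meets them with equally labelled leaves counted once.\<close>

theorem theorem2p5:
  shows "\<exists>const :: nat. \<forall>(N :: nat) (n :: nat) (s :: nat) (r :: nat)
    (As :: bool list set list) (Bs :: bool list set list) (U :: bool list set) (V :: bool list set)
    (e :: nat) (\<epsilon> :: real) (\<C> :: bool list set list pmf)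
    (\<pi> :: bool list set list \<Rightarrow> bool list set list) (k :: nat) (t :: nat).
    N = n + s + r \<and> N \<ge> 1 \<and> n \<ge> 1 \<and>
    set As \<subseteq> Pow (cube (n + s)) \<and> set Bs \<subseteq> Pow (cube (n + r)) \<and>
    U = proj_set n s As \<and> V = proj_set n r Bs \<and> U \<inter> V = {} \<and>
    (\<forall>u \<in> cube n. \<forall>u' \<in> cube n. \<forall>b \<in> cube s.
       (\<forall>A \<in> set As. u @ b \<in> A) \<and> coord_le u u' \<longrightarrow> (\<forall>A \<in> set As. u' @ b \<in> A)) \<and>
    e \<ge> 1 \<and> \<epsilon> > 0 \<and>
    (\<forall>Cs \<in> set_pmf \<C>. length Cs = e \<and> set Cs \<subseteq> Pow (cube N)) \<and>
    eps_approx \<epsilon> (cube N) (cube N) (map_pmf (\<lambda>Cs. \<Inter> (set Cs)) \<C>) \<and>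
    (\<forall>Cs \<in> set_pmf \<C>.
       semantic_refutation (cube N) (map (cyl_A n s r) As @ map (cyl_B n s r) Bs @ Cs) (\<pi> Cs) \<and>
       length (\<pi> Cs) = k \<and>
       (\<forall>D \<in> set (\<pi> Cs). set_MCC n s r D \<le> enat t))
    \<longrightarrow>
    (\<exists>\<P>. random_protocol U V {..<n} (KWm n U V) \<epsilon> \<P> \<and>
       random_size \<P> \<le> enat (k + n + e) \<and> random_size \<P> \<le> enat (2 * k + n) \<and>
       random_CC U V \<P> \<le> enat (const * t) \<and>
       ((\<forall>Cs \<in> set_pmf \<C>. treelike_refutation (cube N)
            (map (cyl_A n s r) As @ map (cyl_B n s r) Bs @ Cs) (\<pi> Cs)) \<longrightarrow>
          (\<forall>P \<in> set_pmf \<P>. is_tree_sharing_leaves P))) \<and>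
    ((\<forall>Cs \<in> set_pmf \<C>. treelike_refutation (cube N)
         (map (cyl_A n s r) As @ map (cyl_B n s r) Bs @ Cs) (\<pi> Cs)) \<longrightarrow>
       (\<exists>\<P>. random_protocol U V {..<n} (KWm n U V) \<epsilon> \<P> \<and>
          random_size_mod_labels \<P> \<le> enat (k + n + e) \<and>
          random_size_mod_labels \<P> \<le> enat (2 * k + n) \<and>
          random_CC U V \<P> \<le> enat (const * t) \<and>
          (\<forall>P \<in> set_pmf \<P>. is_tree P)))"
proof (intro exI[of _ 2] allI impI, elim conjE)
  fix N n s r :: nat and As Bs :: "bool list set list" and U V :: "bool list set"
    and e :: nat and \<epsilon> :: real and \<C> :: "bool list set list pmf"
    and \<pi> :: "bool list set list \<Rightarrow> bool list set list" and k t :: nat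
  assume N: "N = n + s + r" and n: "n \<ge> 1" and UV: "U = proj_set n s As" "V = proj_set n r Bs"
    and mono: "\<forall>u \<in> cube n. \<forall>u' \<in> cube n. \<forall>b \<in> cube s.
       (\<forall>A \<in> set As. u @ b \<in> A) \<and> coord_le u u' \<longrightarrow> (\<forall>A \<in> set As. u' @ b \<in> A)"
    and eps: "\<epsilon> > 0"
    and approx: "eps_approx \<epsilon> (cube N) (cube N) (map_pmf (\<lambda>Cs. \<Inter> (set Cs)) \<C>)"
    and ref: "\<forall>Cs \<in> set_pmf \<C>.
       semantic_refutation (cube N) (map (cyl_A n s r) As @ map (cyl_B n s r) Bs @ Cs) (\<pi> Cs) \<and>
       length (\<pi> Cs) = k \<and>
       (\<forall>D \<in> set (\<pi> Cs). set_MCC n s r D \<le> enat t)"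
  let ?E = "\<lambda>Cs. map (cyl_A n s r) As @ map (cyl_B n s r) Bs @ Cs"
  let ?uniq = "\<lambda>Cs J. \<forall>j i i'. i < length (\<pi> Cs) \<and> i' < length (\<pi> Cs) \<and>
    premise_of J j i \<and> premise_of J j i' \<longrightarrow> i = i'"
  let ?treelike = "\<lambda>Cs. treelike_refutation (cube N) (?E Cs) (\<pi> Cs)"
  \<comment> \<open>A justification witnessing tree-likeness is itself a derivation, so one
    \<open>J\<close> serves both cases.\<close>
  have "\<forall>Cs \<in> set_pmf \<C>. \<exists>J. derivation (?E Cs) (\<pi> Cs) J \<and> (?treelike Cs \<longrightarrow> ?uniq Cs J)"
    using ref unfolding semantic_refutation_def treelike_refutation_def by meson
  from bchoice[OF this] obtain J where J: "\<forall>Cs \<in> set_pmf \<C>.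
      derivation (?E Cs) (\<pi> Cs) (J Cs) \<and> (?treelike Cs \<longrightarrow> ?uniq Cs (J Cs))"
    by blast
  have mr: "monotone_refutation n s r As Bs Cs (\<pi> Cs) (J Cs) t" if "Cs \<in> set_pmf \<C>" for Cs
  proof
    show "n \<ge> 1" by (rule n)
    show "\<forall>A \<in> set As. u' @ b \<in> A" if "u \<in> cube n" "u' \<in> cube n" "b \<in> cube s"
      "\<forall>A \<in> set As. u @ b \<in> A" "coord_le u u'" for u u' b
      using mono that by blast
    show "\<pi> Cs \<noteq> []" "last (\<pi> Cs) = {}"
      using ref that unfolding semantic_refutation_def by blast+
    show "derivation (?E Cs) (\<pi> Cs) (J Cs)" using J that by blast
    show "set_MCC n s r X \<le> enat t" if "X \<in> set (\<pi> Cs)" for X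
      using ref \<open>Cs \<in> set_pmf \<C>\<close> that by blast
  qed
  have len: "length (\<pi> Cs) = k" if "Cs \<in> set_pmf \<C>" for Cs
    using ref that by blast
  \<comment> \<open>\<open>m = 0\<close> shares the leaves and serves the size bound in nodes;
    \<open>m = 1\<close> makes them private and yields a tree.\<close>
  define \<P> where
    "\<P> m = map_pmf (\<lambda>Cs. monotone_refutation.proto n s r As Bs (\<pi> Cs) (J Cs) t m) \<C>" for m
  have P: "random_protocol U V {..<n} (KWm n U V) \<epsilon> (\<P> m)" "random_CC U V (\<P> m) \<le> enat (2 * t)" for m
    using random_protocol_of_refutations[OF mr approx[unfolded N] eps] unfolding UV \<P>_def by blast+
  have "random_size (\<P> 0) \<le> enat (k + n)"
    unfolding random_size_def
  proof (rule SUP_least)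
    fix P assume "P \<in> set_pmf (\<P> 0)"
    then show "enat (card (nodes P)) \<le> enat (k + n)"
      using monotone_refutation.card_nodes_proto[OF mr refl] len unfolding \<P>_def by fastforce
  qed
  \<comment> \<open>The single bound \<open>k + n\<close> lies below both required ones.\<close>
  then have size: "random_size (\<P> 0) \<le> enat (k + n + e)" "random_size (\<P> 0) \<le> enat (2 * k + n)"
    by (rule order_trans; simp)+
  have "random_size_mod_labels (\<P> 1) \<le> enat (k + n)"
    unfolding random_size_mod_labels_def
  proof (rule SUP_least)
    fix P assume "P \<in> set_pmf (\<P> 1)"
    then show "enat (card (inner_nodes P) + card (lab P ` leaves P)) \<le> enat (k + n)"
      using monotone_refutation.card_inner_labels_proto[OF mr] len unfolding \<P>_def by fastforce
  qed
  then have size_mod: "random_size_mod_labels (\<P> 1) \<le> enat (k + n + e)"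
    "random_size_mod_labels (\<P> 1) \<le> enat (2 * k + n)"
    by (rule order_trans; simp)+
  have tree: "(\<forall>P \<in> set_pmf (\<P> 0). is_tree_sharing_leaves P) \<and> (\<forall>P \<in> set_pmf (\<P> 1). is_tree P)"
    if "\<forall>Cs \<in> set_pmf \<C>. ?treelike Cs"
  proof -
    have uniq: "?uniq Cs (J Cs)" if "Cs \<in> set_pmf \<C>" for Cs
      using J \<open>\<forall>Cs \<in> set_pmf \<C>. ?treelike Cs\<close> that by blast
    have "is_tree_sharing_leaves (monotone_refutation.proto n s r As Bs (\<pi> Cs) (J Cs) t 0)"
      "is_tree (monotone_refutation.proto n s r As Bs (\<pi> Cs) (J Cs) t 1)" if "Cs \<in> set_pmf \<C>" for Cs
      using uniq[OF that]
      by (blast intro!: monotone_refutation.is_tree_sharing_leaves_proto[OF mr[OF that]]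
          monotone_refutation.is_tree_proto[OF mr[OF that] _ refl])+
    then show ?thesis unfolding \<P>_def by auto
  qed
  show "(\<exists>\<P>. random_protocol U V {..<n} (KWm n U V) \<epsilon> \<P> \<and>
       random_size \<P> \<le> enat (k + n + e) \<and> random_size \<P> \<le> enat (2 * k + n) \<and>
       random_CC U V \<P> \<le> enat (2 * t) \<and>
       ((\<forall>Cs \<in> set_pmf \<C>. ?treelike Cs) \<longrightarrow> (\<forall>P \<in> set_pmf \<P>. is_tree_sharing_leaves P))) \<and>
    ((\<forall>Cs \<in> set_pmf \<C>. ?treelike Cs) \<longrightarrow>
       (\<exists>\<P>. random_protocol U V {..<n} (KWm n U V) \<epsilon> \<P> \<and>
          random_size_mod_labels \<P> \<le> enat (k + n + e) \<and>
          random_size_mod_labels \<P> \<le> enat (2 * k + n) \<and>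
          random_CC U V \<P> \<le> enat (2 * t) \<and>
          (\<forall>P \<in> set_pmf \<P>. is_tree P)))"
    using P size size_mod tree by blast
qed

end
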